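(* Let $l_0,m_0\in\mathbb{Z}$ and let $\bar d_{l,m}$ be a real-valued function of lattice points $(l,m)$. 1. Suppose $\bar d_{l,m}$ is defined for $l\ge l_0$, $m\ge m_0$ and satisfies $$\bar d_{l+1,m+1}-\bar d_{l,m+1}-\bar d_{l+1,m}+\bar d_{l,m}=0\qquad\text{for all } l\ge l_0,\ m\ge m_0 .$$ If the initial values $\bar d_{l_0,m}$ ($m\ge m_0$) are linear in $m$ and the initial values $\bar d_{l,m_0}$ ($l\ge l_0$) are linear in $l$, then $\bar d_{l,m}$ grows linearly in both the horizontal and the vertical directions. 2. Suppose $\bar d_{l,m}$ is defined for $l\ge l_0-1$, $m\ge m_0$ and satisfies $$\bar d_{l+1,m+1}-\bar d_{l,m}-\bar d_{l,m+1}+\bar d_{l-1,m}=0\qquad\text{for all } l\ge l_0,\ m\ge m_0 .$$ If the initial values $\bar d_{l_0-1,m}$ and $\bar d_{l_0,m}$ ($m\ge m_0$) are each linear in $m$ and the initial values $\bar d_{l,m_0}$ ($l\ge l_0$) are linear in $l$, then $\bar d_{l,m}$ grows linearly along the horizontal direction. 3. Suppose $\bar d_{l,m}$ is defined for $l\ge l_0$, $m\ge m_0-1$ and satisfies $$\bar d_{l+1,m+1}-\bar d_{l+1,m}-\bar d_{l,m}+\bar d_{l,m-1}=0\qquad\text{for all } l\ge l_0,\ m\ge m_0 .$$ If the initial values $\bar d_{l_0,m}$ ($m\ge m_0$) are linear in $m$ and the initial values $\bar d_{l,m_0}$ and $\bar d_{l,m_0-1}$ ($l\ge l_0$) are each linear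 in $l$, then $\bar d_{l,m}$ grows linearly along the vertical direction.
   Context: All indices $l,m$ are integers. "Linear in $l$" (or in $m$) means given by a polynomial of degree at most $1$ in that index, i.e. of the form $al+b$ with constants $a,b$, on the stated index range. "Grows linearly along the horizontal direction" means: for each fixed $m\ge m_0$ there are constants $a,b$ (possibly depending on $m$) such that $\bar d_{l,m}=al+b$ for all sufficiently large $l$. "Grows linearly along the vertical direction" means: for each fixed $l\ge l_0$ there are constants $a,b$ (possibly depending on $l$) such that $\bar d_{l,m}=am+b$ for all sufficiently large $m$. (The slope $a$ is allowed to be $0$.) *)

theory Defs
  imports Complex_Main
begin

definition linear_from :: "int \<Rightarrow> (int \<Rightarrow> real) \<Rightarrow> bool" where
  "linear_from k f \<longleftrightarrow> (\<exists>a b. \<forall>n\<ge>k. f n = a * of_int n + b)"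

definition eventually_linear :: "(int \<Rightarrow> real) \<Rightarrow> bool" where
  "eventually_linear f \<longleftrightarrow> (\<exists>a b. \<forall>\<^sub>F n in at_top. f n = a * of_int n + b)"

text \<open>A lattice function is a total function \<open>d\<close> with \<open>d l m\<close> the value at \<open>(l, m)\<close>; values
  outside the region of interest are arbitrary. The constants \<open>a\<close>, \<open>b\<close> and the threshold may
  depend on the fixed index.\<close>

definition grows_linearly_horizontally :: "int \<Rightarrow> (int \<Rightarrow> int \<Rightarrow> real) \<Rightarrow> bool" where
  "grows_linearly_horizontally m0 d \<longleftrightarrow> (\<forall>m\<ge>m0. eventually_linear (\<lambda>l. d l m))"

definition grows_linearly_vertically :: "int \<Rightarrow> (int \<Rightarrow> int \<Rightarrow> real) \<Rightarrow> bool" where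
  "grows_linearly_vertically l0 d \<longleftrightarrow> (\<forall>l\<ge>l0. eventually_linear (\<lambda>m. d l m))"

end

theory Submission imports Defs
begin

text \<open>Each equation says that the first difference of \<open>d\<close> in one index is transported
  unchanged (up to a shift of that index) when the other index grows by one. A function is
  eventually linear iff its first difference is eventually constant, so eventual linearity
  propagates from the initial line to all later ones.\<close>

lemma linear_from_imp_eventually_linear:
  assumes "linear_from k f"
  shows "eventually_linear f"
proof -
  obtain a b where "\<forall>n\<ge>k. f n = a * of_int n + b"
    using assms unfolding linear_from_def by blast
  then show ?thesis
    unfolding eventually_linear_def eventually_at_top_linorder by blast
qed

text \<open>Telescoping from \<open>N\<close>: the slope is the common difference, and the intercept
  is fixed by the value at \<open>N\<close>.\<close>

lemma eventually_linear_if_constant_difference: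
  assumes diff: "\<And>n. n \<ge> N \<Longrightarrow> g (n + 1) - g n = a"
  shows "eventually_linear g"
proof -
  have "g n = a * of_int n + (g N - a * of_int N)" if "n \<ge> N" for n
    using that
  proof (induction n rule: int_ge_induct)
    case (step i)
    then show ?case using diff[of i] by (simp add: algebra_simps)
  qed simp
  then show ?thesis
    unfolding eventually_linear_def eventually_at_top_linorder by blast
qed

text \<open>The differences of \<open>f\<close> are eventually its slope, and a shift by
  \<open>k\<close> does not change a constant, so \<open>g\<close> inherits that slope.\<close>

lemma eventually_linear_shifted_difference:
  assumes "eventually_linear f"
    and diff: "\<And>n. n \<ge> M \<Longrightarrow> g (n + 1) - g n = f (n + 1 + k) - f (n + k)"
  shows "eventually_linear g"
proof -
  obtain a b N where f: "\<And>n. n \<ge> N \<Longrightarrow> f n = a * of_int n + b"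
    using assms(1) unfolding eventually_linear_def eventually_at_top_linorder by blast
  show ?thesis
  proof (rule eventually_linear_if_constant_difference)
    \<comment> \<open>Past \<open>M\<close> the difference identity applies; past
      \<open>N - k\<close> both \<open>n + k\<close> and \<open>n + 1 + k\<close> lie where
      \<open>f\<close> is affine.\<close>
    fix n assume "n \<ge> max M (N - k)"
    then show "g (n + 1) - g n = a"
      using diff[of n] f[of "n + k"] f[of "n + 1 + k"] by (simp add: algebra_simps)
  qed
qed

text \<open>The shift \<open>k\<close> lets one induction on \<open>m\<close> serve all three
  equations. For negative \<open>k\<close> the range on which linearity is shown starts
  \<open>-k\<close> later in each new row, so the induction carries eventual linearity instead of
  \<open>linear_from l0\<close>.\<close>

lemma grows_linearly_horizontally_if_difference_transported:
  assumes "linear_from l0 (\<lambda>l. d l m0)"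
    and diff: "\<And>l m. l \<ge> l0 \<Longrightarrow> m \<ge> m0 \<Longrightarrow>
      d (l + 1) (m + 1) - d l (m + 1) = d (l + 1 + k) m - d (l + k) m"
  shows "grows_linearly_horizontally m0 d"
  unfolding grows_linearly_horizontally_def
proof (intro allI impI)
  fix m assume "m0 \<le> m"
  then show "eventually_linear (\<lambda>l. d l m)"
  proof (induction m rule: int_ge_induct)
    case base
    show ?case using assms(1) by (rule linear_from_imp_eventually_linear)
  next
    case (step m)
    then show ?case
      using diff by (intro eventually_linear_shifted_difference[OF step.IH, of l0 _ k]) auto
  qed
qed

text \<open>Reduces every vertical claim to a horizontal one for the transposed function.\<close>

lemma grows_linearly_vertically_iff_transpose:
  "grows_linearly_vertically l0 d \<longleftrightarrow> grows_linearly_horizontally l0 (\<lambda>l m. d m l)"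
  unfolding grows_linearly_vertically_def grows_linearly_horizontally_def ..

theorem theorem2:
  fixes l0 m0 :: int
  shows
    "(\<forall>d :: int \<Rightarrow> int \<Rightarrow> real.
        (\<forall>l\<ge>l0. \<forall>m\<ge>m0. d (l + 1) (m + 1) - d l (m + 1) - d (l + 1) m + d l m = 0) \<and>
        linear_from m0 (\<lambda>m. d l0 m) \<and>
        linear_from l0 (\<lambda>l. d l m0)
        \<longrightarrow> grows_linearly_horizontally m0 d \<and> grows_linearly_vertically l0 d) \<and>
     (\<forall>d :: int \<Rightarrow> int \<Rightarrow> real.
        (\<forall>l\<ge>l0. \<forall>m\<ge>m0. d (l + 1) (m + 1) - d l m - d l (m + 1) + d (l - 1) m = 0) \<and>
        linear_from m0 (\<lambda>m. d (l0 - 1) m) \<and>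
        linear_from m0 (\<lambda>m. d l0 m) \<and>
        linear_from l0 (\<lambda>l. d l m0)
        \<longrightarrow> grows_linearly_horizontally m0 d) \<and>
     (\<forall>d :: int \<Rightarrow> int \<Rightarrow> real.
        (\<forall>l\<ge>l0. \<forall>m\<ge>m0. d (l + 1) (m + 1) - d (l + 1) m - d l m + d l (m - 1) = 0) \<and>
        linear_from m0 (\<lambda>m. d l0 m) \<and>
        linear_from l0 (\<lambda>l. d l m0) \<and>
        linear_from l0 (\<lambda>l. d l (m0 - 1))
        \<longrightarrow> grows_linearly_vertically l0 d)"
proof (intro conjI allI impI; (elim conjE)?; (unfold grows_linearly_vertically_iff_transpose)?)
  fix d :: "int \<Rightarrow> int \<Rightarrow> real"
  assume eq: "\<forall>l\<ge>l0. \<forall>m\<ge>m0. d (l + 1) (m + 1) - d l (m + 1) - d (l + 1) m + d l m = 0"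
  {
    assume "linear_from l0 (\<lambda>l. d l m0)"
    then show "grows_linearly_horizontally m0 d"
      by (rule grows_linearly_horizontally_if_difference_transported[where k = 0])
        (use eq in \<open>force simp: algebra_simps\<close>)
  next
    assume "linear_from m0 (\<lambda>m. d l0 m)"
    \<comment> \<open>The first equation is symmetric in the two indices, so the transpose satisfies
      it too, again with \<open>k = 0\<close>.\<close>
    then show "grows_linearly_horizontally l0 (\<lambda>l m. d m l)"
      by (rule grows_linearly_horizontally_if_difference_transported[where k = 0])
        (use eq in \<open>force simp: algebra_simps\<close>)
  }
next
  fix d :: "int \<Rightarrow> int \<Rightarrow> real"
  assume eq: "\<forall>l\<ge>l0. \<forall>m\<ge>m0. d (l + 1) (m + 1) - d l m - d l (m + 1) + d (l - 1) m = 0"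
    and "linear_from l0 (\<lambda>l. d l m0)"
  \<comment> \<open>Rearranged, the equation reads
    \<open>d (l + 1) (m + 1) - d l (m + 1) = d l m - d (l - 1) m\<close>: the difference moves one
    place to the right per row, hence \<open>k = -1\<close>.\<close>
  from this(2) show "grows_linearly_horizontally m0 d"
    by (rule grows_linearly_horizontally_if_difference_transported[where k = "-1"])
      (use eq in \<open>force simp: algebra_simps\<close>)
next
  fix d :: "int \<Rightarrow> int \<Rightarrow> real"
  assume eq: "\<forall>l\<ge>l0. \<forall>m\<ge>m0. d (l + 1) (m + 1) - d (l + 1) m - d l m + d l (m - 1) = 0"
    and "linear_from m0 (\<lambda>m. d l0 m)"
  \<comment> \<open>The third equation is the second with the indices exchanged, so the transpose
    again has \<open>k = -1\<close>.\<close>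
  from this(2) show "grows_linearly_horizontally l0 (\<lambda>l m. d m l)"
    by (rule grows_linearly_horizontally_if_difference_transported[where k = "-1"])
      (use eq in \<open>force simp: algebra_simps\<close>)
qed

end
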